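(* Let $G$ be a finite group and let $(\pi,V,\alpha)$ be a projective representation of $G$. For any linear map $f:V\to V$ define $$\langle f\rangle_\pi:=\frac1{|G|}\sum_{g\in G}\pi(g)^{-1}f\,\pi(g).$$ (1) For every linear map $f:V\to V$, the eigenspaces of $\langle f\rangle_\pi$ are projective representations of $G$ with multiplier $\alpha$ (that is, each eigenspace is invariant under $\pi(g)$ for all $g\in G$, and restricting $\pi$ to it gives a projective representation with multiplier $\alpha$). (2) Let $\{f_i\}_{i=1}^{(\dim V)^2}$ be a basis of the vector space of linear maps $V\to V$. Then $\pi$ is irreducible if and only if $\langle f_i\rangle_\pi$ is a scalar multiple of the identity map of $V$ for all $1\le i\le(\dim V)^2$.
   Context: A multiplier on $G$ is a function $\alpha:G\times G\to\mathbb{C}^\times$ with $\alpha(x,y)\alpha(xy,z)=\alpha(x,yz)\alpha(y,z)$ for all $x,y,z\in G$ and $\alpha(x,1)=\alpha(1,x)=1$ for all $x\in G$. A projective representation $(\pi,V,\alpha)$ of $G$ over a finite-dimensional complex vector space $V$ with multiplier $\alpha$ is a function $\pi:G\to\mathrm{GL}(V)$ with $\pi(x)\pi(y)=\alpha(x,y)\pi(xy)$ for all $x,y\in G$. It is irreducible if there is no nontrivial proper subspace of $V$ that is invariant under $\pi(g)$ for all $g\in G$. *)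

theory Defs
  imports Complex_Main "HOL-Library.Function_Algebras" "HOL-Algebra.Bij"
begin

definition multiplier ::
  "('g, 'm) monoid_scheme \<Rightarrow> ('g \<Rightarrow> 'g \<Rightarrow> complex) \<Rightarrow> bool" where
  "multiplier G \<alpha> \<longleftrightarrow>
     (\<forall>x\<in>carrier G. \<forall>y\<in>carrier G. \<alpha> x y \<noteq> 0) \<and>
     (\<forall>x\<in>carrier G. \<forall>y\<in>carrier G. \<forall>z\<in>carrier G.
        \<alpha> x y * \<alpha> (x \<otimes>\<^bsub>G\<^esub> y) z = \<alpha> x (y \<otimes>\<^bsub>G\<^esub> z) * \<alpha> y z) \<and>
     (\<forall>x\<in>carrier G. \<alpha> x \<one>\<^bsub>G\<^esub> = 1 \<and> \<alpha> \<one>\<^bsub>G\<^esub> x = 1)"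

text \<open>
  Representation spaces are linear subspaces \<open>V\<close> of an ambient complex vector space
  \<open>(scale, 'v)\<close>, so that a representation and its restriction to a subspace are instances of
  the same notion; an abstract vector space is the case \<open>V = UNIV\<close>. Elements of \<open>GL(V)\<close> are
  functions in \<open>Bij V\<close>, hence extensional (\<open>undefined\<close> outside \<open>V\<close>, which is void if
  \<open>V = UNIV\<close>).
\<close>

definition general_linear ::
  "(complex \<Rightarrow> 'v \<Rightarrow> 'v) \<Rightarrow> 'v::ab_group_add set \<Rightarrow> ('v \<Rightarrow> 'v) set" where
  "general_linear scale V =
     {f \<in> Bij V. (\<forall>u\<in>V. \<forall>v\<in>V. f (u + v) = f u + f v) \<and>
                 (\<forall>c. \<forall>v\<in>V. f (scale c v) = scale c (f v))}"

locale projective_representation = group G + vector_space scale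
  for G :: "('g, 'm) monoid_scheme" (structure)
    and scale :: "complex \<Rightarrow> 'v::ab_group_add \<Rightarrow> 'v" +
  fixes V :: "'v set"
    and \<alpha> :: "'g \<Rightarrow> 'g \<Rightarrow> complex"
    and \<pi> :: "'g \<Rightarrow> 'v \<Rightarrow> 'v"
  assumes multiplier: "multiplier G \<alpha>"
    and subspace_V: "subspace V"
    and finite_dimensional_V: "\<exists>B. finite B \<and> span B = V"
    and general_linear: "x \<in> carrier G \<Longrightarrow> \<pi> x \<in> general_linear scale V"
    and mult: "\<lbrakk>x \<in> carrier G; y \<in> carrier G; v \<in> V\<rbrakk> \<Longrightarrow>
                 \<pi> x (\<pi> y v) = scale (\<alpha> x y) (\<pi> (x \<otimes> y) v)"

definition invariant ::
  "('g, 'm) monoid_scheme \<Rightarrow> ('g \<Rightarrow> 'v \<Rightarrow> 'v) \<Rightarrow> 'v set \<Rightarrow> bool" where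
  "invariant G \<pi> W \<longleftrightarrow> (\<forall>g\<in>carrier G. \<pi> g ` W \<subseteq> W)"

text \<open>As in the definition \<open>no nontrivial proper invariant subspace\<close>, the zero space counts as
  irreducible.\<close>

definition irreducible_rep ::
  "('g, 'm) monoid_scheme \<Rightarrow> (complex \<Rightarrow> 'v \<Rightarrow> 'v) \<Rightarrow> 'v::ab_group_add set \<Rightarrow>
     ('g \<Rightarrow> 'v \<Rightarrow> 'v) \<Rightarrow> bool" where
  "irreducible_rep G scale V \<pi> \<longleftrightarrow>
     \<not> (\<exists>W. module.subspace scale W \<and> W \<subseteq> V \<and> W \<noteq> {0} \<and> W \<noteq> V \<and> invariant G \<pi> W)"

text \<open>The inverse is that of the linear map \<open>\<pi> g\<close> on \<open>V\<close>; in general it differs from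
  \<open>\<pi>\<close> applied to the group inverse of \<open>g\<close>.\<close>

definition average ::
  "('g, 'm) monoid_scheme \<Rightarrow> (complex \<Rightarrow> 'v \<Rightarrow> 'v) \<Rightarrow> 'v::ab_group_add set \<Rightarrow>
     ('g \<Rightarrow> 'v \<Rightarrow> 'v) \<Rightarrow> ('v \<Rightarrow> 'v) \<Rightarrow> 'v \<Rightarrow> 'v" where
  "average G scale V \<pi> f v =
     scale (1 / of_nat (card (carrier G))) (\<Sum>g\<in>carrier G. inv_into V (\<pi> g) (f (\<pi> g v)))"

definition eigenspace :: "(complex \<Rightarrow> 'v \<Rightarrow> 'v) \<Rightarrow> ('v \<Rightarrow> 'v) \<Rightarrow> complex \<Rightarrow> 'v set" where
  "eigenspace scale f c = {v. f v = scale c v}"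

definition eigenvalue ::
  "(complex \<Rightarrow> 'v \<Rightarrow> 'v) \<Rightarrow> ('v::zero \<Rightarrow> 'v) \<Rightarrow> complex \<Rightarrow> bool" where
  "eigenvalue scale f c \<longleftrightarrow> (\<exists>v. v \<noteq> 0 \<and> f v = scale c v)"

definition fun_scale :: "(complex \<Rightarrow> 'v \<Rightarrow> 'v) \<Rightarrow> complex \<Rightarrow> ('a \<Rightarrow> 'v) \<Rightarrow> 'a \<Rightarrow> 'v" where
  "fun_scale scale c f = (\<lambda>x. scale c (f x))"

text \<open>Bases of the space of linear endomorphisms of \<open>'v\<close>, viewed inside the vector space of all
  functions \<open>'v \<Rightarrow> 'v\<close> with pointwise operations.\<close>

definition endomorphism_basis ::
  "(complex \<Rightarrow> 'v \<Rightarrow> 'v) \<Rightarrow> 'i set \<Rightarrow> ('i \<Rightarrow> 'v::ab_group_add \<Rightarrow> 'v) \<Rightarrow> bool" where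
  "endomorphism_basis scale I F \<longleftrightarrow>
     inj_on F I \<and>
     \<not> module.dependent (fun_scale scale) (F ` I) \<and>
     module.span (fun_scale scale) (F ` I) = {f. Vector_Spaces.linear scale scale f}"

end

theory Submission
  imports Defs "HOL-Computational_Algebra.Fundamental_Theorem_Algebra"
begin

text \<open>
  The averaged map \<open>\<langle>f\<rangle>\<close> commutes with every \<open>\<pi> h\<close>: conjugating the summand of \<open>g\<close> by \<open>\<pi> h\<close>
  gives the summand of \<open>g \<otimes> h\<close>, because the scalar \<open>\<alpha> g h\<close> that separates \<open>\<pi> g \<circ> \<pi> h\<close> from
  \<open>\<pi> (g \<otimes> h)\<close> occurs once inverted and once not, and a linear \<open>f\<close> lets the two cancel
  (\<open>average_commutes\<close>). Hence \<open>\<pi> h\<close> and its inverse both preserve the eigenspaces of \<open>\<langle>f\<rangle>\<close>,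
  which is the first claim.

  If \<open>\<pi>\<close> is irreducible, this gives Schur's lemma: over the complex numbers \<open>\<langle>f\<rangle>\<close> has an
  eigenvalue, whose eigenspace is nonzero and invariant, hence everything.

  Conversely, \<open>f \<mapsto> \<langle>f\<rangle>\<close> is linear, so if it maps a basis to scalars it maps every linear map
  to a scalar. Apply this to a linear projection \<open>p\<close> onto an invariant subspace \<open>W\<close>
  (Maschke's argument). Invariance makes \<open>\<langle>p\<rangle>\<close> again a projection onto \<open>W\<close>; a
  projection that is a scalar is the zero map or the identity, so \<open>W\<close> is zero or everything.
\<close>

section \<open>Eigenvalues of a linear map on a finite-dimensional complex space\<close>

text \<open>The vector \<open>p(f) v\<close>, computed by Horner's scheme: with this recursion its laws follow by
  induction over \<open>pCons\<close>, without comparing degrees.\<close>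

definition poly_apply ::
  "(complex \<Rightarrow> 'v \<Rightarrow> 'v) \<Rightarrow> ('v \<Rightarrow> 'v) \<Rightarrow> 'v::ab_group_add \<Rightarrow> complex poly \<Rightarrow> 'v" where
  "poly_apply scale f v p = fold_coeffs (\<lambda>a w. scale a v + f w) p 0"

context
  fixes scale :: "complex \<Rightarrow> 'v::ab_group_add \<Rightarrow> 'v" and f :: "'v \<Rightarrow> 'v" and v :: 'v
  assumes lin: "Vector_Spaces.linear scale scale f"
begin

interpretation f: Vector_Spaces.linear scale scale f by (fact lin)

lemma poly_apply_0: "poly_apply scale f v 0 = 0"
  by (simp add: poly_apply_def)

lemma poly_apply_pCons:
  "poly_apply scale f v (pCons a p) = scale a v + f (poly_apply scale f v p)"
proof (cases "p = 0 \<and> a = 0")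
  case True
  then show ?thesis by (simp add: poly_apply_def f.zero)
next
  case False
  then have "fold_coeffs (\<lambda>a w. scale a v + f w) (pCons a p) =
      (\<lambda>w. scale a v + f w) \<circ> fold_coeffs (\<lambda>a w. scale a v + f w) p"
    by (cases "p = 0") (auto simp: fold_coeffs_pCons_not_0_0_eq fold_coeffs_pCons_coeff_not_0_eq)
  then show ?thesis by (simp add: poly_apply_def)
qed

lemma poly_apply_add:
  "poly_apply scale f v (p + q) = poly_apply scale f v p + poly_apply scale f v q"
  by (induction p q rule: poly_induct2)
     (simp_all add: poly_apply_0 poly_apply_pCons f.add f.vs1.scale_left_distrib algebra_simps)

lemma poly_apply_smult:
  "poly_apply scale f v (smult c p) = scale c (poly_apply scale f v p)"
  by (induction p)
     (simp_all add: poly_apply_0 poly_apply_pCons f.scale f.vs1.scale_right_distrib)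

lemma poly_apply_linear_factor:
  "poly_apply scale f v ([:- c, 1:] * p) =
     f (poly_apply scale f v p) - scale c (poly_apply scale f v p)"
  by (simp add: poly_apply_add poly_apply_smult poly_apply_pCons flip: smult_minus_left)

lemma poly_apply_monom: "poly_apply scale f v (monom a i) = scale a ((f ^^ i) v)"
  by (induction i) (simp_all add: monom_0 monom_Suc poly_apply_pCons poly_apply_0 f.zero f.scale)

lemma poly_apply_sum:
  "poly_apply scale f v (\<Sum>i\<in>I. p i) = (\<Sum>i\<in>I. poly_apply scale f v (p i))"
  by (induction I rule: infinite_finite_induct) (simp_all add: poly_apply_0 poly_apply_add)

text \<open>The iterates \<open>v, f v, f (f v), \<dots>\<close> cannot be independent in a finite-dimensional space; a
  dependence between them is an annihilating polynomial. Two iterates may also coincide, and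
  then the set of iterates alone does not show the dependence.\<close>

lemma annihilating_polynomial_exists:
  assumes "finite B" and "f.vs1.span B = UNIV"
  shows "\<exists>p. p \<noteq> 0 \<and> poly_apply scale f v p = 0"
proof (cases "inj (\<lambda>i. (f ^^ i) v)")
  case False
  then obtain i j where ij: "i \<noteq> j" "(f ^^ i) v = (f ^^ j) v"
    by (auto simp: inj_on_def)
  let ?p = "monom 1 i + monom (- 1) j :: complex poly"
  have "coeff ?p i = 1"
    using ij by simp
  then have "?p \<noteq> 0" by (metis coeff_0 zero_neq_one)
  moreover have "poly_apply scale f v ?p = 0"
    using ij by (simp add: poly_apply_add poly_apply_monom)
  ultimately show ?thesis by blast
next
  case True
  then have "infinite (range (\<lambda>i. (f ^^ i) v))"
    using finite_imageD by blast
  then have "f.vs1.dependent (range (\<lambda>i. (f ^^ i) v))"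
    using f.vs1.independent_span_bound[OF assms(1)] assms(2) by blast
  then obtain T u where T: "finite T" "T \<subseteq> range (\<lambda>i. (f ^^ i) v)"
      "\<exists>w\<in>T. u w \<noteq> 0" "(\<Sum>w\<in>T. scale (u w) w) = 0"
    unfolding f.vs1.dependent_explicit by blast
  obtain I where I: "finite I" "T = (\<lambda>i. (f ^^ i) v) ` I"
    using finite_subset_image[OF T(1,2)] by blast
  let ?p = "\<Sum>i\<in>I. monom (u ((f ^^ i) v)) i"
  obtain i where i: "i \<in> I" "u ((f ^^ i) v) \<noteq> 0"
    using T(3) I(2) by blast
  have "coeff ?p i = u ((f ^^ i) v)"
    using i I(1) by (simp add: coeff_sum coeff_monom)
  with i have "?p \<noteq> 0" by (metis coeff_0)
  moreover have "poly_apply scale f v ?p = 0"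
  proof -
    have "inj_on (\<lambda>i. (f ^^ i) v) I"
      using True inj_on_subset by blast
    then have "(\<Sum>w\<in>T. scale (u w) w) = (\<Sum>i\<in>I. scale (u ((f ^^ i) v)) ((f ^^ i) v))"
      unfolding I(2) by (simp add: sum.reindex)
    with T(4) show ?thesis
      by (simp add: poly_apply_sum poly_apply_monom)
  qed
  ultimately show ?thesis by blast
qed

text \<open>Splitting off one root \<open>c\<close>, either the cofactor \<open>q\<close> still annihilates \<open>v\<close>, or \<open>q(f) v\<close> is an
  eigenvector for \<open>c\<close>.\<close>

lemma eigenvalue_if_annihilated:
  assumes "v \<noteq> 0" "p \<noteq> 0" "poly_apply scale f v p = 0"
  shows "\<exists>c. eigenvalue scale f c"
  using assms(2,3)
proof (induction "degree p" arbitrary: p rule: less_induct)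
  case less
  show ?case
  proof (cases "degree p = 0")
    case True
    then obtain a where "p = [:a:]" using degree_eq_zeroE by blast
    with less.prems \<open>v \<noteq> 0\<close> show ?thesis
      by (simp add: poly_apply_pCons poly_apply_0 f.zero)
  next
    case False
    then have "\<not> constant (poly p)" by (simp add: constant_degree)
    then obtain c where "poly p c = 0"
      using fundamental_theorem_of_algebra by blast
    then obtain q where q: "p = [:- c, 1:] * q"
      unfolding poly_eq_0_iff_dvd dvd_def by blast
    with less.prems have "q \<noteq> 0" by auto
    then have "degree q < degree p"
      unfolding q by (subst degree_mult_eq) auto
    show ?thesis
    proof (cases "poly_apply scale f v q = 0")
      case True
      with less.hyps \<open>degree q < degree p\<close> \<open>q \<noteq> 0\<close> show ?thesis by blast
    next
      case False
      moreover have "f (poly_apply scale f v q) = scale c (poly_apply scale f v q)"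
        using less.prems(2) unfolding q poly_apply_linear_factor by simp
      ultimately show ?thesis unfolding eigenvalue_def by blast
    qed
  qed
qed

end

lemma eigenvalue_exists:
  fixes scale :: "complex \<Rightarrow> 'v::ab_group_add \<Rightarrow> 'v"
  assumes "Vector_Spaces.linear scale scale f"
    and "finite B" "module.span scale B = UNIV" and "(v::'v) \<noteq> 0"
  shows "\<exists>c. eigenvalue scale f c"
  using annihilating_polynomial_exists[OF assms(1-3)] eigenvalue_if_annihilated[OF assms(1,4)]
  by blast

section \<open>Averaging over the group\<close>

locale finite_group_representation = projective_representation G scale UNIV \<alpha> \<pi>
  for G :: "('g, 'm) monoid_scheme" (structure)
    and scale :: "complex \<Rightarrow> 'v::ab_group_add \<Rightarrow> 'v"
    and \<alpha> :: "'g \<Rightarrow> 'g \<Rightarrow> complex"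
    and \<pi> :: "'g \<Rightarrow> 'v \<Rightarrow> 'v" +
  assumes finite_carrier: "finite (carrier G)"
begin

abbreviation avg :: "('v \<Rightarrow> 'v) \<Rightarrow> 'v \<Rightarrow> 'v" where
  "avg \<equiv> average G scale UNIV \<pi>"

abbreviation \<pi>_inv :: "'g \<Rightarrow> 'v \<Rightarrow> 'v" where
  "\<pi>_inv g \<equiv> inv_into UNIV (\<pi> g)"

lemma bij_rep: "g \<in> carrier G \<Longrightarrow> bij (\<pi> g)"
  using general_linear by (auto simp: general_linear_def Bij_def)

lemma rep_add: "g \<in> carrier G \<Longrightarrow> \<pi> g (u + v) = \<pi> g u + \<pi> g v"
  using general_linear by (auto simp: general_linear_def)

lemma rep_scale: "g \<in> carrier G \<Longrightarrow> \<pi> g (scale c v) = scale c (\<pi> g v)"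
  using general_linear by (auto simp: general_linear_def)

lemma rep_linear: "g \<in> carrier G \<Longrightarrow> Vector_Spaces.linear scale scale (\<pi> g)"
  by unfold_locales (simp_all add: rep_add rep_scale)

lemma rep_inv_right [simp]: "g \<in> carrier G \<Longrightarrow> \<pi> g (\<pi>_inv g v) = v"
  by (meson bij_rep bij_inv_eq_iff)

lemma rep_inv_left [simp]: "g \<in> carrier G \<Longrightarrow> \<pi>_inv g (\<pi> g v) = v"
  by (simp add: bij_rep bij_is_inj)

lemma rep_inv_eqI: "g \<in> carrier G \<Longrightarrow> \<pi> g w = v \<Longrightarrow> \<pi>_inv g v = w"
  by auto

lemma rep_inv_add: "g \<in> carrier G \<Longrightarrow> \<pi>_inv g (u + v) = \<pi>_inv g u + \<pi>_inv g v"
  by (rule rep_inv_eqI) (simp_all add: rep_add)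

lemma rep_inv_scale: "g \<in> carrier G \<Longrightarrow> \<pi>_inv g (scale c v) = scale c (\<pi>_inv g v)"
  by (rule rep_inv_eqI) (simp_all add: rep_scale)

lemma alpha_nonzero: "x \<in> carrier G \<Longrightarrow> y \<in> carrier G \<Longrightarrow> \<alpha> x y \<noteq> 0"
  using multiplier by (auto simp: multiplier_def)

lemma alpha_one: "\<alpha> \<one> \<one> = 1"
  using multiplier by (auto simp: multiplier_def)

lemma rep_one: "\<pi> \<one> v = v"
proof -
  have "\<pi> \<one> (\<pi> \<one> v) = \<pi> \<one> v"
    using mult[of \<one> \<one> v] by (simp add: alpha_one)
  then show ?thesis
    using bij_rep[OF one_closed] by (simp add: bij_def inj_eq)
qed

text \<open>The inverse of \<open>\<pi> g\<close> is a scalar multiple of \<open>\<pi>\<close> at the group inverse, so it preserves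
  every invariant subspace.\<close>

lemma rep_inv_invariant:
  assumes "subspace W" "invariant G \<pi> W" "g \<in> carrier G" "w \<in> W"
  shows "\<pi>_inv g w \<in> W"
proof -
  let ?h = "m_inv G g"
  have "\<pi> ?h w = scale (\<alpha> ?h g) (\<pi>_inv g w)"
    using mult[of ?h g "\<pi>_inv g w"] assms(3) by (simp add: rep_one)
  then have "scale (inverse (\<alpha> ?h g)) (\<pi> ?h w) = \<pi>_inv g w"
    using alpha_nonzero assms(3) by simp
  moreover have "\<pi> ?h w \<in> W"
    using assms(2-4) by (auto simp: invariant_def)
  ultimately show ?thesis
    using subspace_scale[OF assms(1)] by metis
qed

lemma average_fun_add: "avg (f + f') v = avg f v + avg f' v"
  by (simp add: average_def rep_inv_add sum.distrib scale_right_distrib)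

lemma average_fun_scale: "avg (fun_scale scale c f) v = scale c (avg f v)"
  by (simp add: average_def fun_scale_def rep_inv_scale scale_left_commute
      flip: scale_sum_right)

lemma average_linear:
  assumes "Vector_Spaces.linear scale scale f"
  shows "Vector_Spaces.linear scale scale (avg f)"
proof -
  interpret f: Vector_Spaces.linear scale scale f by (fact assms)
  show ?thesis
    by unfold_locales
       (simp_all add: average_def rep_add rep_scale f.add f.scale rep_inv_add rep_inv_scale
         sum.distrib scale_right_distrib scale_left_commute flip: scale_sum_right)
qed

lemma average_eqI:
  assumes "\<And>g. g \<in> carrier G \<Longrightarrow> \<pi>_inv g (f (\<pi> g v)) = w"
  shows "avg f v = w"
proof -
  have "of_nat (card (carrier G)) \<noteq> (0::complex)"
    using finite_carrier one_closed by (auto simp: card_eq_0_iff)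
  then show ?thesis
    using assms by (simp add: average_def sum_constant_scale)
qed

text \<open>Since \<open>\<pi> g \<circ> \<pi> h\<close> is \<open>\<pi> (g \<otimes> h)\<close> up to a scalar, and scalars do not affect conjugation of a
  linear map, moving \<open>\<pi> h\<close> through the average only permutes the summands by right
  multiplication with \<open>h\<close>.\<close>

lemma average_commutes:
  assumes "Vector_Spaces.linear scale scale f" and h: "h \<in> carrier G"
  shows "avg f (\<pi> h v) = \<pi> h (avg f v)"
proof -
  interpret f: Vector_Spaces.linear scale scale f by (fact assms)
  interpret h: Vector_Spaces.linear scale scale "\<pi> h" by (rule rep_linear[OF h])
  have summand: "\<pi>_inv g (f (\<pi> g (\<pi> h v))) = \<pi> h (\<pi>_inv (g \<otimes> h) (f (\<pi> (g \<otimes> h) v)))"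
    if "g \<in> carrier G" for g
    using that h by (intro rep_inv_eqI) (simp_all add: mult f.scale)
  have "(\<Sum>g\<in>carrier G. \<pi>_inv g (f (\<pi> g (\<pi> h v)))) =
      (\<Sum>g\<in>carrier G. \<pi> h (\<pi>_inv g (f (\<pi> g v))))"
    by (rule sum.reindex_bij_witness[where i = "\<lambda>g. g \<otimes> m_inv G h" and j = "\<lambda>g. g \<otimes> h"])
       (simp_all add: h m_assoc summand)
  then show ?thesis
    by (simp add: average_def h.scale h.sum)
qed

section \<open>Eigenspaces as subrepresentations\<close>

lemma eigenspace_subspace:
  assumes "Vector_Spaces.linear scale scale f"
  shows "subspace (eigenspace scale f c)"
proof -
  interpret f: Vector_Spaces.linear scale scale f by (fact assms)
  show ?thesis
    by (rule subspaceI)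
       (simp_all add: eigenspace_def f.zero f.add f.scale scale_right_distrib scale_left_commute)
qed

lemma eigenspace_average_invariant:
  assumes "Vector_Spaces.linear scale scale f"
  shows "invariant G \<pi> (eigenspace scale (avg f) c)"
  using average_commutes[OF assms]
  by (auto simp: invariant_def eigenspace_def rep_scale)

text \<open>Invariance alone gives \<open>\<pi> g ` W \<subseteq> W\<close>; that the restriction is onto \<open>W\<close> comes from the
  invariance of \<open>W\<close> under the inverse maps.\<close>

lemma restrict_to_invariant_subspace:
  assumes W: "subspace W" "invariant G \<pi> W"
  shows "projective_representation G scale W \<alpha> (\<lambda>g. restrict (\<pi> g) W)"
proof
  show "multiplier G \<alpha>" by (fact multiplier)
  show "subspace W" by (fact W)
  obtain B where B: "finite B" "span B = UNIV"
    using finite_dimensional_V by blast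
  obtain C where C: "C \<subseteq> W" "independent C" "W \<subseteq> span C"
    using basis_exists[of W] by metis
  have "finite C"
    using independent_span_bound[OF B(1) C(2)] B(2) by blast
  moreover have "span C = W"
    using C span_minimal[OF C(1) W(1)] by blast
  ultimately show "\<exists>B. finite B \<and> span B = W" by blast
next
  fix g assume g: "g \<in> carrier G"
  have image: "\<pi> g w \<in> W" if "w \<in> W" for w
    using W(2) g that by (auto simp: invariant_def)
  have "bij_betw (\<pi> g) W W"
    by (rule bij_betwI[where g = "\<pi>_inv g"])
       (simp_all add: g image rep_inv_invariant[OF W g])
  then have "bij_betw (restrict (\<pi> g) W) W W"
    by (simp cong: bij_betw_cong)
  then show "restrict (\<pi> g) W \<in> general_linear scale W"
    using W(1) g
    by (simp add: general_linear_def Bij_def rep_add rep_scale subspace_add subspace_scale)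
next
  fix x y w assume "x \<in> carrier G" "y \<in> carrier G" "w \<in> W"
  moreover from this have "\<pi> y w \<in> W"
    using W(2) by (auto simp: invariant_def)
  ultimately show "restrict (\<pi> x) W (restrict (\<pi> y) W w) =
      scale (\<alpha> x y) (restrict (\<pi> (x \<otimes> y)) W w)"
    by (simp add: mult)
qed

section \<open>Irreducibility and scalar averages\<close>

text \<open>Schur's lemma for the intertwiner \<open>avg f\<close>. The zero space has no eigenvalues, but there every
  map is a scalar.\<close>

lemma average_scalar_if_irreducible:
  assumes "irreducible_rep G scale UNIV \<pi>" and f: "Vector_Spaces.linear scale scale f"
  shows "\<exists>c. avg f = (\<lambda>v. scale c v)"
proof (cases "\<exists>v::'v. v \<noteq> 0")
  case True
  then obtain v :: 'v where "v \<noteq> 0" by blast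
  obtain B where "finite B" "span B = UNIV"
    using finite_dimensional_V by blast
  then obtain c where c: "eigenvalue scale (avg f) c"
    using eigenvalue_exists[OF average_linear[OF f] _ _ \<open>v \<noteq> 0\<close>] by blast
  let ?E = "eigenspace scale (avg f) c"
  have "?E \<noteq> {0}"
    using c by (auto simp: eigenvalue_def eigenspace_def)
  then have "?E = UNIV"
    using assms(1) eigenspace_subspace[OF average_linear[OF f]] eigenspace_average_invariant[OF f]
    by (auto simp: irreducible_rep_def)
  then show ?thesis by (auto simp: eigenspace_def)
next
  case False
  then have "avg f = (\<lambda>v. scale 0 v)" by auto
  then show ?thesis by blast
qed

text \<open>Maschke's argument: the average of a projection \<open>p\<close> onto \<open>W\<close> fixes \<open>W\<close> pointwise and has its
  range in \<open>W\<close>. If it is a scalar, a nonzero vector of \<open>W\<close> forces the scalar to be \<open>1\<close>, so the range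
  is everything.\<close>

lemma invariant_subspace_trivial_if_averages_scalar:
  assumes scalar: "\<And>f. Vector_Spaces.linear scale scale f \<Longrightarrow> \<exists>c. avg f = (\<lambda>v. scale c v)"
    and W: "subspace W" "invariant G \<pi> W" and "W \<noteq> {0}"
  shows "W = UNIV"
proof -
  interpret vector_space_pair scale scale ..
  obtain p where p: "Vector_Spaces.linear scale scale p" "range p \<subseteq> W" "\<And>w. w \<in> W \<Longrightarrow> p w = w"
    using linear_exists_left_inverse_on[OF linear_id W(1)] by auto
  obtain c where c: "avg p = (\<lambda>v. scale c v)"
    using scalar[OF p(1)] by blast
  obtain w where w: "w \<in> W" "w \<noteq> 0"
    using \<open>W \<noteq> {0}\<close> subspace_0[OF W(1)] by blast
  have "avg p w = w"
  proof (rule average_eqI)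
    fix g assume g: "g \<in> carrier G"
    then have "\<pi> g w \<in> W"
      using W(2) w(1) by (auto simp: invariant_def)
    with g show "\<pi>_inv g (p (\<pi> g w)) = w"
      by (simp add: p(3))
  qed
  with c w have "c = 1" by (metis scale_cancel_right scale_one)
  have "avg p v \<in> W" for v
    unfolding average_def
    using p(2) rep_inv_invariant[OF W] by (intro subspace_scale subspace_sum W(1)) auto
  with c \<open>c = 1\<close> show ?thesis by auto
qed

lemma vector_space_fun_scale:
  "vector_space (fun_scale scale :: complex \<Rightarrow> ('a \<Rightarrow> 'v) \<Rightarrow> 'a \<Rightarrow> 'v)"
  by unfold_locales
     (simp_all add: fun_scale_def fun_eq_iff scale_right_distrib scale_left_distrib)

text \<open>Averaging is linear in the averaged map, so the maps with scalar average form a subspace.\<close>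

lemma average_scalar_if_scalar_on_spanning_set:
  assumes "\<And>f. f \<in> S \<Longrightarrow> \<exists>c. avg f = (\<lambda>v. scale c v)"
    and "f \<in> module.span (fun_scale scale) S"
  shows "\<exists>c. avg f = (\<lambda>v. scale c v)"
proof -
  interpret funs: vector_space "fun_scale scale :: complex \<Rightarrow> ('v \<Rightarrow> 'v) \<Rightarrow> _"
    by (rule vector_space_fun_scale)
  have "funs.subspace {f. \<exists>c. avg f = (\<lambda>v. scale c v)}"
  proof (rule funs.subspaceI; clarify)
    have "avg 0 = (\<lambda>v. scale 0 v)"
      using average_fun_scale[of 0 0] by (simp add: fun_eq_iff fun_scale_def zero_fun_def)
    then show "\<exists>c. avg 0 = (\<lambda>v. scale c v)" by blast
  next
    fix f f' c c' assume "avg f = (\<lambda>v. scale c v)" "avg f' = (\<lambda>v. scale c' v)"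
    then have "avg (f + f') = (\<lambda>v. scale (c + c') v)"
      by (simp add: fun_eq_iff average_fun_add scale_left_distrib)
    then show "\<exists>c. avg (f + f') = (\<lambda>v. scale c v)" by blast
  next
    fix d f c assume "avg f = (\<lambda>v. scale c v)"
    then have "avg (fun_scale scale d f) = (\<lambda>v. scale (d * c) v)"
      by (simp add: fun_eq_iff average_fun_scale)
    then show "\<exists>c. avg (fun_scale scale d f) = (\<lambda>v. scale c v)" by blast
  qed
  moreover have "S \<subseteq> {f. \<exists>c. avg f = (\<lambda>v. scale c v)}"
    using assms(1) by (simp add: subset_iff)
  ultimately have "funs.span S \<subseteq> {f. \<exists>c. avg f = (\<lambda>v. scale c v)}"
    by (intro funs.span_minimal)
  from subsetD[OF this assms(2)] show ?thesis by simp
qed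

lemma irreducible_iff_averages_scalar:
  assumes "module.span (fun_scale scale) S = {f. Vector_Spaces.linear scale scale f}"
  shows "irreducible_rep G scale UNIV \<pi> \<longleftrightarrow> (\<forall>f\<in>S. \<exists>c. avg f = (\<lambda>v. scale c v))"
proof
  interpret funs: vector_space "fun_scale scale :: complex \<Rightarrow> ('v \<Rightarrow> 'v) \<Rightarrow> _"
    by (rule vector_space_fun_scale)
  assume "irreducible_rep G scale UNIV \<pi>"
  moreover have "Vector_Spaces.linear scale scale f" if "f \<in> S" for f
    using funs.span_base[OF that] assms by blast
  ultimately show "\<forall>f\<in>S. \<exists>c. avg f = (\<lambda>v. scale c v)"
    using average_scalar_if_irreducible by blast
next
  assume S: "\<forall>f\<in>S. \<exists>c. avg f = (\<lambda>v. scale c v)"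
  have "\<exists>c. avg f = (\<lambda>v. scale c v)" if "Vector_Spaces.linear scale scale f" for f
    by (rule average_scalar_if_scalar_on_spanning_set[of S]) (simp_all add: S that assms)
  then show "irreducible_rep G scale UNIV \<pi>"
    unfolding irreducible_rep_def using invariant_subspace_trivial_if_averages_scalar by blast
qed

end

theorem theorem3:
  fixes G :: "('g, 'm) monoid_scheme"
    and scale :: "complex \<Rightarrow> 'v::ab_group_add \<Rightarrow> 'v"
    and \<alpha> :: "'g \<Rightarrow> 'g \<Rightarrow> complex"
    and \<pi> :: "'g \<Rightarrow> 'v \<Rightarrow> 'v"
  assumes "finite (carrier G)"
    and "projective_representation G scale UNIV \<alpha> \<pi>"
  shows "(\<forall>f c. Vector_Spaces.linear scale scale f \<longrightarrow>
            eigenvalue scale (average G scale UNIV \<pi> f) c \<longrightarrow>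
            (let E = eigenspace scale (average G scale UNIV \<pi> f) c
             in invariant G \<pi> E \<and>
                projective_representation G scale E \<alpha> (\<lambda>g. restrict (\<pi> g) E)))
       \<and> (\<forall>F :: nat \<Rightarrow> 'v \<Rightarrow> 'v.
            endomorphism_basis scale {1..(vector_space.dim scale UNIV)\<^sup>2} F \<longrightarrow>
            (irreducible_rep G scale UNIV \<pi> \<longleftrightarrow>
               (\<forall>i\<in>{1..(vector_space.dim scale UNIV)\<^sup>2}.
                  \<exists>c. average G scale UNIV \<pi> (F i) = (\<lambda>v. scale c v))))"
proof -
  interpret finite_group_representation G scale \<alpha> \<pi>
    using assms by (simp add: finite_group_representation_def finite_group_representation_axioms_def)
  have "invariant G \<pi> E \<and> projective_representation G scale E \<alpha> (\<lambda>g. restrict (\<pi> g) E)"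
    if "Vector_Spaces.linear scale scale f" "E = eigenspace scale (avg f) c" for f c E
    using that eigenspace_average_invariant eigenspace_subspace[OF average_linear]
      restrict_to_invariant_subspace by blast
  moreover have "irreducible_rep G scale UNIV \<pi> \<longleftrightarrow>
      (\<forall>i\<in>I. \<exists>c. avg (F i) = (\<lambda>v. scale c v))"
    if "endomorphism_basis scale I F" for I :: "nat set" and F
    using irreducible_iff_averages_scalar[of "F ` I"] that by (simp add: endomorphism_basis_def)
  ultimately show ?thesis by (simp add: Let_def)
qed

end
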